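(* Consider Perturbed Smoothed GDA run with constant parameters satisfying the step-size conditions for Perturbed Smoothed GDA listed in the context, where the perturbation parameter is $r_y=\Theta(\epsilon/D_{\mathcal Y})$ in item (i) and $r_y=\Theta\big(\epsilon^2/(\ell D_{\mathcal Y}^2)\big)$ in item (ii). Let $(x^T,y^T,z^T)$ denote the output after $T$ iterations. Then there exist an $\ell$-smooth function $f$ (with domains $\mathcal X,\mathcal Y$, satisfying the assumptions in the context) and an initialization $(x^0,y^0,z^0)$ such that both of the following hold: (i) (Game stationarity) Perturbed Smoothed GDA requires at least $T=\Omega\big(\ell^2D_{\mathcal Y}\Delta_{\Psi_2}/\epsilon^3\big)$ iterations to guarantee that $(x^T,y^T)$ is an $\epsilon$-GS of $\min_{x\in\mathcal X}\max_{y\in\mathcal Y}f(x,y)$. (ii) (Optimization stationarity) Perturbed Smoothed GDA requires at least $T=\Omega\big(\ell^3D_{\mathcal Y}^2\Delta_{\Psi_2}/\epsilon^4\big)$ iterations to guarantee that $x^T$ is an $\epsilon$-OS of $\min_{x\in\mathcal X}\max_{y\in\mathcal Y}f(x,y)$.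
   Context: Setting: $f:\mathbb R^n\times\mathbb R^d\to\mathbb R$; $\mathcal X\subseteq\mathbb R^n$ is nonempty, closed and convex; $\mathcal Y\subseteq\mathbb R^d$ is nonempty, compact and convex with $0\in\mathcal Y$ and diameter $D_{\mathcal Y}>0$. The function $f$ is continuously differentiable and $\ell$-smooth ($\ell>0$): for all $x,x'\in\mathcal X$, $y,y'\in\mathcal Y$, both $\|\nabla_xf(x,y)-\nabla_xf(x',y')\|$ and $\|\nabla_yf(x,y)-\nabla_yf(x',y')\|$ are at most $\ell(\|x-x'\|+\|y-y'\|)$. For each $x\in\mathcal X$, $f(x,\cdot)$ is concave. Stationarity: $\iota_S$ is the indicator function of a set $S$ ($0$ on $S$, $+\infty$ outside), and $\partial\iota_S$ its subdifferential. A pair $(x,y)\in\mathcal X\times\mathcal Y$ is an $\epsilon$-game-stationary point ($\epsilon$-GS) if $\mathrm{dist}(0,\nabla_xf(x,y)+\partial\iota_{\mathcal X}(x))\le\epsilon$ and $\mathrm{dist}(0,-\nabla_yf(x,y)+\partial\iota_{\mathcal Y}(y))\le\epsilon$. Let $\Phi(x)=\max_{y'\in\mathcal Y}f(x,y')+\iota_{\mathcal X}(x)$. A point $x\in\mathcal X$ is an $\epsilon$-optimization-stationary point ($\epsilon$-OS) if $\|\mathrm{prox}_{\frac{1}{2\ell}\Phi}(x)-x\|\le\frac{\epsilon}{2\ell}$, where $\mathrm{prox}_{\frac1{2\ell}\Phi}(x)=\arg\min_{w}\{\Phi(w)+\ell\|w-x\|^2\}$. Perturbed Smoothed GDA (constant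 parameters): let $F_0(x,y,z)=f(x,y)+\frac{r_x}{2}\|x-z\|^2-\frac{r_y}{2}\|y\|^2$. From $(x^0,y^0,z^0)$, iterate $$x^{t+1}=\mathrm{proj}_{\mathcal X}(x^t-c\nabla_xF_0(x^t,y^t,z^t)),\quad y^{t+1}=\mathrm{proj}_{\mathcal Y}(y^t+\alpha\nabla_yF_0(x^{t+1},y^t,z^t)),\quad z^{t+1}=z^t+\beta(x^{t+1}-z^t).$$ Step-size conditions for Perturbed Smoothed GDA: $r_x=\Theta(\ell)$ with $r_x>3\ell$, $r_y>0$, and: $\alpha=\Theta(1/\ell)$ and $0<\alpha\le\min\Big\{\frac{1}{11(\ell+r_y)},\frac{c^2(r_x-\ell-r_y)^2}{4(\ell+r_y)(1+c(r_x-\ell-r_y))^2}\Big\}$; $c=\Theta(1/\ell)$ and $0<c<\frac{1}{r_x+\ell+r_y}$; $0<\beta\le\min\Big\{\frac1{36},\frac{(r_x-\ell-r_y)^2}{384r_x(r_x+\ell+r_y)^2}\Big\}$; $\beta=\Theta(r_y/\ell)$ and $0<\beta\le\frac{1}{384r_x\alpha\omega^2}$, where $\omega=\frac{1}{\sqrt{r_y}}\cdot\frac{(r_x-\ell-r_y)+\alpha(\ell+r_y)(3r_x-2\ell-2r_y)}{\alpha(r_x-\ell-r_y)^{3/2}}$. Initial gap: with $f_0(x,y)=f(x,y)-\frac{r_y}{2}\|y\|^2$, $\Delta_{\Psi_2}=\Psi_2^0(x^0,y^0,z^0)-\min_{x\in\mathcal X}\max_{y\in\mathcal Y}f_0(x,y)$,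 where $\Psi_2^0(x,y,z)=F_0(x,y,z)-2\min_{x'\in\mathcal X}F_0(x',y,z)+2\min_{x'\in\mathcal X}\max_{y'\in\mathcal Y}F_0(x',y',z)$ (with the $r_y$ of the item concerned). Conventions: $\epsilon\in(0,1)$ is a sufficiently small positive number. "Requires at least $T=\Omega(\cdot)$ iterations" means that any $T$ for which the $T$-th iterate has the stated stationarity property satisfies $T=\Omega(\cdot)$. $\Omega$ and $\Theta$ hide positive constants not depending on $\epsilon,\ell,D_{\mathcal Y},\Delta_{\Psi_2},T$. *)

theory Defs
  imports "HOL-Analysis.Analysis" "HOL-Library.Extended_Real"
begin

definition grad :: "('a::real_inner \<Rightarrow> real) \<Rightarrow> 'a \<Rightarrow> 'a" where
  "grad g x = (THE D. GDERIV g x :> D)"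

definition grad_x :: "('a::real_inner \<Rightarrow> 'b \<Rightarrow> real) \<Rightarrow> 'a \<Rightarrow> 'b \<Rightarrow> 'a" where
  "grad_x f x y = grad (\<lambda>x'. f x' y) x"

definition grad_y :: "('a \<Rightarrow> 'b::real_inner \<Rightarrow> real) \<Rightarrow> 'a \<Rightarrow> 'b \<Rightarrow> 'b" where
  "grad_y f x y = grad (\<lambda>y'. f x y') y"

definition continuously_differentiable :: "('a::real_inner \<Rightarrow> real) \<Rightarrow> bool" where
  "continuously_differentiable g \<longleftrightarrow>
     (\<forall>p. g differentiable (at p)) \<and> continuous_on UNIV (grad g)"

definition l_smooth_on ::
  "real \<Rightarrow> 'a::real_inner set \<Rightarrow> 'b::real_inner set \<Rightarrow> ('a \<Rightarrow> 'b \<Rightarrow> real) \<Rightarrow> bool" where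
  "l_smooth_on l X Y f \<longleftrightarrow>
     (\<forall>x\<in>X. \<forall>x'\<in>X. \<forall>y\<in>Y. \<forall>y'\<in>Y.
        norm (grad_x f x y - grad_x f x' y') \<le> l * (norm (x - x') + norm (y - y')) \<and>
        norm (grad_y f x y - grad_y f x' y') \<le> l * (norm (x - x') + norm (y - y')))"

definition minimax_problem ::
  "real \<Rightarrow> 'a::euclidean_space set \<Rightarrow> 'b::euclidean_space set \<Rightarrow> ('a \<Rightarrow> 'b \<Rightarrow> real) \<Rightarrow> bool" where
  "minimax_problem l X Y f \<longleftrightarrow>
     l > 0 \<and>
     X \<noteq> {} \<and> closed X \<and> convex X \<and>
     Y \<noteq> {} \<and> compact Y \<and> convex Y \<and> 0 \<in> Y \<and> diameter Y > 0 \<and>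
     continuously_differentiable (\<lambda>(x, y). f x y) \<and>
     l_smooth_on l X Y f \<and>
     (\<forall>x\<in>X. concave_on Y (f x))"

definition indicator_fun :: "'a set \<Rightarrow> 'a \<Rightarrow> ereal" where
  "indicator_fun S x = (if x \<in> S then 0 else \<infinity>)"

definition subdifferential :: "('a::real_inner \<Rightarrow> ereal) \<Rightarrow> 'a \<Rightarrow> 'a set" where
  "subdifferential g x =
     {v. \<bar>g x\<bar> \<noteq> \<infinity> \<and> (\<forall>w. g w \<ge> g x + ereal (v \<bullet> (w - x)))}"

text \<open>For \<open>x \<in> X\<close> and \<open>y \<in> Y\<close> both subdifferentials below contain \<open>0\<close>, so the
  convention \<^term>\<open>infdist a {} = 0\<close> plays no role.\<close>

definition game_stationary ::
  "real \<Rightarrow> 'a::real_inner set \<Rightarrow> 'b::real_inner set \<Rightarrow> ('a \<Rightarrow> 'b \<Rightarrow> real) \<Rightarrow> 'a \<Rightarrow> 'b \<Rightarrow> bool"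
where
  "game_stationary \<epsilon> X Y f x y \<longleftrightarrow>
     x \<in> X \<and> y \<in> Y \<and>
     infdist 0 ((\<lambda>v. grad_x f x y + v) ` subdifferential (indicator_fun X) x) \<le> \<epsilon> \<and>
     infdist 0 ((\<lambda>v. - grad_y f x y + v) ` subdifferential (indicator_fun Y) y) \<le> \<epsilon>"

definition Phi :: "'a set \<Rightarrow> 'b set \<Rightarrow> ('a \<Rightarrow> 'b \<Rightarrow> real) \<Rightarrow> 'a \<Rightarrow> ereal" where
  "Phi X Y f x = ereal (SUP y\<in>Y. f x y) + indicator_fun X x"

text \<open>\<open>prox \<mu> g x\<close> is the proximal point of \<open>\<mu> g\<close> at \<open>x\<close>; for \<open>\<mu> = 1 / (2 * l)\<close> the quadratic
  term is \<open>l * (norm (w - x))\<^sup>2\<close>. For \<open>g = Phi X Y f\<close> with \<open>f\<close> as in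
  \<^const>\<open>minimax_problem\<close> the minimiser exists and is unique.\<close>

definition prox :: "real \<Rightarrow> ('a::real_inner \<Rightarrow> ereal) \<Rightarrow> 'a \<Rightarrow> 'a" where
  "prox \<mu> g x = arg_min (\<lambda>w. g w + ereal ((norm (w - x))\<^sup>2 / (2 * \<mu>))) (\<lambda>_. True)"

definition optimization_stationary ::
  "real \<Rightarrow> real \<Rightarrow> 'a::real_inner set \<Rightarrow> 'b set \<Rightarrow> ('a \<Rightarrow> 'b \<Rightarrow> real) \<Rightarrow> 'a \<Rightarrow> bool" where
  "optimization_stationary \<epsilon> l X Y f x \<longleftrightarrow>
     x \<in> X \<and> norm (prox (1 / (2 * l)) (Phi X Y f) x - x) \<le> \<epsilon> / (2 * l)"

definition F0 ::
  "real \<Rightarrow> real \<Rightarrow> ('a::real_inner \<Rightarrow> 'b::real_inner \<Rightarrow> real) \<Rightarrow> 'a \<Rightarrow> 'b \<Rightarrow> 'a \<Rightarrow> real" where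
  "F0 r\<^sub>x r\<^sub>y f x y z = f x y + r\<^sub>x / 2 * (norm (x - z))\<^sup>2 - r\<^sub>y / 2 * (norm y)\<^sup>2"

definition f0 :: "real \<Rightarrow> ('a \<Rightarrow> 'b::real_inner \<Rightarrow> real) \<Rightarrow> 'a \<Rightarrow> 'b \<Rightarrow> real" where
  "f0 r\<^sub>y f x y = f x y - r\<^sub>y / 2 * (norm y)\<^sup>2"

definition psgda_step ::
  "'a::euclidean_space set \<Rightarrow> 'b::euclidean_space set \<Rightarrow> ('a \<Rightarrow> 'b \<Rightarrow> real) \<Rightarrow>
   real \<Rightarrow> real \<Rightarrow> real \<Rightarrow> real \<Rightarrow> real \<Rightarrow> 'a \<times> 'b \<times> 'a \<Rightarrow> 'a \<times> 'b \<times> 'a" where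
  "psgda_step X Y f r\<^sub>x r\<^sub>y c \<alpha> \<beta> = (\<lambda>(x, y, z).
     let x' = closest_point X (x - c *\<^sub>R grad (\<lambda>u. F0 r\<^sub>x r\<^sub>y f u y z) x);
         y' = closest_point Y (y + \<alpha> *\<^sub>R grad (\<lambda>v. F0 r\<^sub>x r\<^sub>y f x' v z) y);
         z' = z + \<beta> *\<^sub>R (x' - z)
     in (x', y', z'))"

definition Psi2 ::
  "'a::real_inner set \<Rightarrow> 'b::real_inner set \<Rightarrow> ('a \<Rightarrow> 'b \<Rightarrow> real) \<Rightarrow>
   real \<Rightarrow> real \<Rightarrow> 'a \<Rightarrow> 'b \<Rightarrow> 'a \<Rightarrow> real" where
  "Psi2 X Y f r\<^sub>x r\<^sub>y x y z =
     F0 r\<^sub>x r\<^sub>y f x y z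
     - 2 * (INF x'\<in>X. F0 r\<^sub>x r\<^sub>y f x' y z)
     + 2 * (INF x'\<in>X. SUP y'\<in>Y. F0 r\<^sub>x r\<^sub>y f x' y' z)"

text \<open>Under \<^const>\<open>minimax_problem\<close> with \<open>r\<^sub>x > l\<close>, all extrema in \<^const>\<open>Psi2\<close> are attained
  (in \<open>x'\<close> by strong convexity, in \<open>y'\<close> by compactness). The minimum over \<open>X\<close> of
  \<open>\<lambda>x. SUP y\<in>Y. f0 r\<^sub>y f x y\<close> need not exist in general; \<open>minimax_attained\<close> says that it does, so
  that the infimum in \<open>Delta_Psi2\<close> is a genuine minimum.\<close>

definition minimax_attained ::
  "'a set \<Rightarrow> 'b::real_inner set \<Rightarrow> ('a \<Rightarrow> 'b \<Rightarrow> real) \<Rightarrow> real \<Rightarrow> bool" where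
  "minimax_attained X Y f r\<^sub>y \<longleftrightarrow>
     (\<exists>x. is_arg_min (\<lambda>x. SUP y\<in>Y. f0 r\<^sub>y f x y) (\<lambda>x. x \<in> X) x)"

definition Delta_Psi2 ::
  "'a::real_inner set \<Rightarrow> 'b::real_inner set \<Rightarrow> ('a \<Rightarrow> 'b \<Rightarrow> real) \<Rightarrow>
   real \<Rightarrow> real \<Rightarrow> 'a \<Rightarrow> 'b \<Rightarrow> 'a \<Rightarrow> real" where
  "Delta_Psi2 X Y f r\<^sub>x r\<^sub>y x y z =
     Psi2 X Y f r\<^sub>x r\<^sub>y x y z - (INF x'\<in>X. SUP y'\<in>Y. f0 r\<^sub>y f x' y')"

text \<open>\<open>Theta k K a b\<close> is \<open>a = \<Theta>(b)\<close> with hidden constants \<open>k\<close> and \<open>K\<close>. Since only finitely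
  many \<open>\<Theta>\<close> relations occur, one pair \<open>k\<close>, \<open>K\<close> (the smallest lower and the largest upper
  constant) serves all of them.\<close>

definition Theta :: "real \<Rightarrow> real \<Rightarrow> real \<Rightarrow> real \<Rightarrow> bool" where
  "Theta k K a b \<longleftrightarrow> k * b \<le> a \<and> a \<le> K * b"

definition omega :: "real \<Rightarrow> real \<Rightarrow> real \<Rightarrow> real \<Rightarrow> real" where
  "omega l r\<^sub>x r\<^sub>y \<alpha> =
     1 / sqrt r\<^sub>y *
     (((r\<^sub>x - l - r\<^sub>y) + \<alpha> * (l + r\<^sub>y) * (3 * r\<^sub>x - 2 * l - 2 * r\<^sub>y))
      / (\<alpha> * (r\<^sub>x - l - r\<^sub>y) powr (3 / 2)))"

definition step_sizes ::
  "real \<Rightarrow> real \<Rightarrow> real \<Rightarrow> real \<Rightarrow> real \<Rightarrow> real \<Rightarrow> real \<Rightarrow> real \<Rightarrow> bool" where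
  "step_sizes k K l r\<^sub>x r\<^sub>y c \<alpha> \<beta> \<longleftrightarrow>
     Theta k K r\<^sub>x l \<and> r\<^sub>x > 3 * l \<and> r\<^sub>y > 0 \<and>
     Theta k K \<alpha> (1 / l) \<and> 0 < \<alpha> \<and>
     \<alpha> \<le> min (1 / (11 * (l + r\<^sub>y)))
             (c\<^sup>2 * (r\<^sub>x - l - r\<^sub>y)\<^sup>2 / (4 * (l + r\<^sub>y) * (1 + c * (r\<^sub>x - l - r\<^sub>y))\<^sup>2)) \<and>
     Theta k K c (1 / l) \<and> 0 < c \<and> c < 1 / (r\<^sub>x + l + r\<^sub>y) \<and>
     0 < \<beta> \<and>
     \<beta> \<le> min (1 / 36) ((r\<^sub>x - l - r\<^sub>y)\<^sup>2 / (384 * r\<^sub>x * (r\<^sub>x + l + r\<^sub>y)\<^sup>2)) \<and>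
     Theta k K \<beta> (r\<^sub>y / l) \<and>
     \<beta> \<le> 1 / (384 * r\<^sub>x * \<alpha> * (omega l r\<^sub>x r\<^sub>y \<alpha>)\<^sup>2)"

end

theory Submission
  imports Defs
begin

text \<open>The hard instance is linear and independent of \<open>y\<close>: on the half-space
  \<open>X = {x. 0 \<le> e \<bullet> x}\<close> take \<open>f x y = 2 \<epsilon> (e \<bullet> x)\<close> and start at
  \<open>x = z = (\<Delta> / (2 \<epsilon>)) e\<close>, \<open>y = 0\<close>. Neither kind of stationarity is possible before \<open>e \<bullet> x\<close>
  has dropped to \<open>\<epsilon> / l\<close>. But \<open>x\<close> cannot run ahead of the anchor \<open>z\<close> by more than
  \<open>2 \<epsilon> / r\<^sub>x\<close>, so \<open>z\<close> moves by at most \<open>2 \<beta> \<epsilon> / r\<^sub>x\<close> per iteration, and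
  \<open>\<beta> = \<Theta>(r\<^sub>y / l)\<close> makes the distance \<open>\<Delta> / (2 \<epsilon>)\<close> take the claimed number of steps.\<close>

section \<open>Gradients of the linear objective and projection onto the half-space\<close>

lemma grad_eqI:
  assumes "GDERIV g x :> D"
  shows "grad g x = D"
  unfolding grad_def
proof (rule the_equality)
  show "GDERIV g x :> D" by (fact assms)
  fix D' assume "GDERIV g x :> D'"
  then have "(\<lambda>h. h \<bullet> D') = (\<lambda>h. h \<bullet> D)"
    using assms has_derivative_unique unfolding gderiv_def by blast
  then have "(D' - D) \<bullet> D' = (D' - D) \<bullet> D" by metis
  then have "(D' - D) \<bullet> (D' - D) = 0" by (simp add: inner_diff_right)
  then show "D' = D" by simp
qed

lemma grad_linear: "grad (\<lambda>x. a * (e \<bullet> x)) x = a *\<^sub>R e"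
  by (rule grad_eqI)
    (auto simp: gderiv_def inner_commute intro!: derivative_eq_intros)

lemma grad_const: "grad (\<lambda>x. c) x = 0"
  by (rule grad_eqI) (auto simp: gderiv_def)

lemma grad_F0_linear_x:
  "grad (\<lambda>u. F0 r s (\<lambda>x y. a * (e \<bullet> x)) u y z) x = a *\<^sub>R e + r *\<^sub>R (x - z)"
  by (rule grad_eqI)
    (auto simp: gderiv_def F0_def power2_norm_eq_inner inner_commute algebra_simps
        intro!: derivative_eq_intros ext)

lemma grad_F0_linear_y:
  "grad (\<lambda>v. F0 r s (\<lambda>x y. a * (e \<bullet> x)) x v z) y = - (s *\<^sub>R y)"
  by (rule grad_eqI)
    (auto simp: gderiv_def F0_def power2_norm_eq_inner inner_commute algebra_simps
        intro!: derivative_eq_intros ext)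

text \<open>A point inside is fixed; a point outside has a negative \<open>e\<close>-coordinate
  while its projection has a nonnegative one. This monotonicity takes the place of an explicit
  formula for the projection.\<close>

lemma closest_point_halfspace:
  fixes e p :: "'a::euclidean_space"
  defines "X \<equiv> {x. 0 \<le> e \<bullet> x}"
  shows "closest_point X p \<in> X" and "e \<bullet> p \<le> e \<bullet> closest_point X p"
proof -
  have "0 \<in> X" by (simp add: X_def)
  moreover have "closed X"
    unfolding X_def using closed_halfspace_ge[of 0 e] by (simp add: inner_commute)
  ultimately show in_X: "closest_point X p \<in> X" by (metis closest_point_in_set empty_iff)
  show "e \<bullet> p \<le> e \<bullet> closest_point X p"
    using in_X closest_point_self[of p X] by (cases "p \<in> X") (auto simp: X_def)
qed

lemma minimax_problem_linear:
  fixes e :: "'a::euclidean_space"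
  assumes "l > 0" "D > 0"
  shows "minimax_problem l {x. 0 \<le> e \<bullet> x} (cball (0::'b::euclidean_space) (D / 2))
    (\<lambda>x y. a * (e \<bullet> x))"
proof -
  \<comment> \<open>Rewritten as one linear functional on the product space, the objective falls
    under \<open>grad_linear\<close>, which makes its joint gradient constant.\<close>
  have eq: "(\<lambda>(x, y). a * (e \<bullet> x)) = (\<lambda>p. a * ((e, 0::'b) \<bullet> p))"
    by (auto simp: fun_eq_iff inner_Pair)
  have "continuously_differentiable (\<lambda>(x, y::'b). a * (e \<bullet> x))"
    unfolding continuously_differentiable_def eq
    by (auto simp: grad_linear intro!: derivative_intros continuous_intros)
  moreover have "(0::'a) \<in> {x. 0 \<le> e \<bullet> x}" by simp
  then have "{x. 0 \<le> e \<bullet> x} \<noteq> {}" by blast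
  moreover have "concave_on (cball (0::'b) (D / 2)) (\<lambda>_. c)" for c :: real
    by (simp add: concave_on_def convex_on_const)
  moreover have "closed {x. 0 \<le> e \<bullet> x}" "convex {x. 0 \<le> e \<bullet> x}"
    using closed_halfspace_ge[of 0 e] convex_halfspace_ge[of 0 e] by (simp_all add: inner_commute)
  ultimately show ?thesis
    using assms
    by (simp add: minimax_problem_def l_smooth_on_def grad_x_def grad_y_def grad_linear grad_const)
qed

section \<open>The initial gap of the potential\<close>

lemma SUP_F0_const:
  assumes "0 \<in> Y" "s > 0"
  shows "(SUP y\<in>Y. F0 r s (\<lambda>x _. g x) x y z) = F0 r s (\<lambda>x _. g x) x 0 z"
  using assms by (intro cSup_eq_maximum) (auto simp: F0_def)

lemma SUP_f0_const:
  assumes "0 \<in> Y" "s > 0"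
  shows "(SUP y\<in>Y. f0 s (\<lambda>x _. g x) x y) = g x"
  using assms by (intro cSup_eq_maximum) (auto simp: f0_def intro!: image_eqI[of _ _ 0])

lemma minimax_attained_linear:
  assumes "0 \<in> Y" "s > 0" "a > 0"
  shows "minimax_attained {x. 0 \<le> e \<bullet> x} Y (\<lambda>x y. a * (e \<bullet> x)) s"
  using assms
  by (auto simp: minimax_attained_def is_arg_min_linorder SUP_f0_const intro!: exI[of _ 0])

text \<open>At \<open>z = x\<close> and \<open>y = 0\<close> the quadratic terms of
  \<open>F0\<close> vanish. The supremum over \<open>Y\<close> is attained at \<open>0\<close>, so
  the two infima in \<open>Psi2\<close> coincide and cancel without being computed. The value is
  free of \<open>r\<close> and \<open>s\<close>, so one initialization can serve both items.\<close>

lemma Delta_Psi2_linear: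
  fixes e x :: "'a::euclidean_space"
  assumes "0 \<in> Y" "s > 0" "a > 0"
  shows "Delta_Psi2 {x. 0 \<le> e \<bullet> x} Y (\<lambda>x y. a * (e \<bullet> x)) r s x 0 x = a * (e \<bullet> x)"
proof -
  have "(INF x\<in>{x. 0 \<le> e \<bullet> x}. a * (e \<bullet> x)) = 0"
    using assms by (intro cInf_eq_minimum) (auto intro!: image_eqI[of _ _ 0])
  moreover have "(SUP y\<in>Y. F0 r s (\<lambda>x y. a * (e \<bullet> x)) w y x) =
      F0 r s (\<lambda>x y. a * (e \<bullet> x)) w 0 x" for w
    using assms(1,2) by (rule SUP_F0_const)
  ultimately show ?thesis
    using assms by (simp add: Delta_Psi2_def Psi2_def SUP_f0_const) (simp add: F0_def)
qed

section \<open>Stationarity forces a small \<open>e\<close>-coordinate\<close>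

text \<open>Off the boundary the normal cone of the half-space is trivial, so the residual in
  \<open>x\<close> is the full gradient norm \<open>a\<close>, which exceeds \<epsilon>.\<close>

lemma game_stationary_linear_inner_le:
  fixes e :: "'a::euclidean_space"
  assumes gs: "game_stationary \<epsilon> {x. 0 \<le> e \<bullet> x} Y (\<lambda>x y. a * (e \<bullet> x)) x y"
    and "norm e = 1" "\<epsilon> < a"
  shows "e \<bullet> x \<le> 0"
proof (rule ccontr)
  assume "\<not> e \<bullet> x \<le> 0"
  then have pos: "e \<bullet> x > 0" by simp
  let ?X = "{x. 0 \<le> e \<bullet> x}"
  have "v = 0" if v: "v \<in> subdifferential (indicator_fun ?X) x" for v
  proof -
    \<comment> \<open>This length keeps \<open>x + t *\<^sub>R v\<close> in the half-space; the
      summand \<open>1\<close> guards against \<open>e \<bullet> v = 0\<close>. Testing the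
      subgradient inequality at that point gives \<open>t * (v \<bullet> v) \<le> 0\<close>.\<close>
    define t where "t = (e \<bullet> x) / (1 + \<bar>e \<bullet> v\<bar>)"
    have t: "t > 0" using pos by (simp add: t_def add_pos_nonneg)
    have "t * \<bar>e \<bullet> v\<bar> \<le> t * (1 + \<bar>e \<bullet> v\<bar>)" using t by (intro mult_left_mono) auto
    also have "\<dots> = e \<bullet> x" by (simp add: t_def)
    finally have "\<bar>t * (e \<bullet> v)\<bar> \<le> e \<bullet> x" using t by (simp add: abs_mult)
    then have mem: "x + t *\<^sub>R v \<in> ?X" by (simp add: inner_add_right)
    have "indicator_fun ?X (x + t *\<^sub>R v) \<ge> indicator_fun ?X x + ereal (v \<bullet> (x + t *\<^sub>R v - x))"
      using v unfolding subdifferential_def by blast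
    then have "t * (v \<bullet> v) \<le> 0" using mem pos by (simp add: indicator_fun_def)
    then have "v \<bullet> v \<le> 0" using t by (simp add: mult_le_0_iff)
    then show "v = 0" by (metis inner_eq_zero_iff inner_ge_zero order_antisym)
  qed
  moreover have "0 \<in> subdifferential (indicator_fun ?X) x"
    using pos by (auto simp: subdifferential_def indicator_fun_def)
  ultimately have "subdifferential (indicator_fun ?X) x = {0}" by blast
  then have "norm (a *\<^sub>R e) \<le> \<epsilon>"
    using gs by (simp add: game_stationary_def grad_x_def grad_linear)
  then show False using assms by simp
qed

text \<open>The unconstrained minimiser of a linear function plus a quadratic is a gradient step,
  and the lower bound on \<open>e \<bullet> x\<close> keeps this step inside the half-space.\<close>

lemma prox_Phi_linear:
  fixes e x :: "'a::euclidean_space"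
  assumes "l > 0" "Y \<noteq> {}" "norm e = 1" "a / (2 * l) \<le> e \<bullet> x"
  shows "prox (1 / (2 * l)) (Phi {x. 0 \<le> e \<bullet> x} Y (\<lambda>x y. a * (e \<bullet> x))) x = x - (a / (2 * l)) *\<^sub>R e"
proof -
  let ?X = "{x. 0 \<le> e \<bullet> x}"
  define p where "p = x - (a / (2 * l)) *\<^sub>R e"
  define q where "q w = a * (e \<bullet> w) + l * (norm (w - x))\<^sup>2" for w
  define h where "h w = Phi ?X Y (\<lambda>x y. a * (e \<bullet> x)) w + ereal ((norm (w - x))\<^sup>2 / (2 * (1 / (2 * l))))" for w
  have h: "h w = (if w \<in> ?X then ereal (q w) else \<infinity>)" for w
    using assms by (simp add: h_def q_def Phi_def indicator_fun_def mult.commute)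
  have ee: "e \<bullet> e = 1" using assms by (simp add: norm_eq_1)
  \<comment> \<open>Completing the square yields both that \<open>p\<close> is a minimiser and that
    it is the only one.\<close>
  have q: "q w = q p + l * (norm (w - p))\<^sup>2" for w
  proof -
    define t where "t = a / (2 * l)"
    have a: "a = 2 * l * t" using assms by (simp add: t_def)
    have "w - p = (w - x) + t *\<^sub>R e" "p - x = - (t *\<^sub>R e)"
      by (simp_all add: p_def t_def)
    then have n: "(norm (w - p))\<^sup>2 = (norm (w - x))\<^sup>2 + 2 * t * (e \<bullet> (w - x)) + t\<^sup>2"
      "(norm (p - x))\<^sup>2 = t\<^sup>2"
      using ee by (simp_all only: power2_norm_eq_inner)
        (simp_all add: inner_add inner_commute power2_eq_square)
    have p: "e \<bullet> p = e \<bullet> x - t"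
      using ee by (simp add: p_def t_def inner_diff_right)
    show ?thesis
      unfolding q_def n p a by (simp add: inner_diff_right algebra_simps power2_eq_square)
  qed
  have p: "p \<in> ?X" using assms ee by (simp add: p_def inner_simps)
  have "h p \<le> h w" for w
    using p assms by (simp add: h q[of w])
  \<comment> \<open>\<open>arg_min\<close> merely chooses some minimiser, so at first only the
    values agree; the square identity with \<open>l > 0\<close> then identifies the points.\<close>
  then have "h (arg_min h (\<lambda>_. True)) = h p"
    by (intro arg_min_equality) auto
  then have "q (arg_min h (\<lambda>_. True)) = q p"
    using p by (simp add: h split: if_splits)
  then have "arg_min h (\<lambda>_. True) = p"
    using assms q[of "arg_min h (\<lambda>_. True)"] by simp
  then show ?thesis by (simp add: prox_def h_def[abs_def] p_def)
qed

text \<open>From height \<open>a / (2 * l)\<close> upwards the proximal point lies at distance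
  exactly \<open>a / (2 * l)\<close>, beyond the tolerance
  \<open>\<epsilon> / (2 * l)\<close>.\<close>

lemma optimization_stationary_linear_inner_less:
  fixes e :: "'a::euclidean_space"
  assumes os: "optimization_stationary \<epsilon> l {x. 0 \<le> e \<bullet> x} Y (\<lambda>x y. a * (e \<bullet> x)) x"
    and "norm e = 1" "0 < \<epsilon>" "\<epsilon> < a" "l > 0" "Y \<noteq> {}"
  shows "e \<bullet> x < a / (2 * l)"
proof (rule ccontr)
  assume "\<not> e \<bullet> x < a / (2 * l)"
  then have "a / (2 * l) \<le> \<epsilon> / (2 * l)"
    using os assms by (simp add: optimization_stationary_def prox_Phi_linear)
  then show False using assms by (simp add: divide_le_cancel)
qed

section \<open>Speed limit of the iteration\<close>

text \<open>The lag \<open>e \<bullet> z - e \<bullet> x\<close> starts at \<open>0\<close> and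
  never passes \<open>a / r\<close>, so each anchor update lowers \<open>e \<bullet> z\<close> by at
  most \<beta> times that bound. The \<open>y\<close>-gradient is \<open>- (s *\<^sub>R y)\<close>,
  so \<open>y\<close> stays at \<open>0\<close>.\<close>

lemma psgda_linear_inner_ge:
  fixes e x\<^sub>0 :: "'a::euclidean_space"
  assumes "norm e = 1" "a > 0" "r > 0" "0 \<le> c" "c * r \<le> 1" "0 \<le> \<beta>" "\<beta> \<le> 1"
    and "0 \<in> Y"
    and "(psgda_step {x. 0 \<le> e \<bullet> x} Y (\<lambda>x y. a * (e \<bullet> x)) r s c \<alpha> \<beta> ^^ T) (x\<^sub>0, 0, x\<^sub>0) = (x, y, z)"
  shows "y = 0 \<and> e \<bullet> z - e \<bullet> x \<le> a / r \<and> e \<bullet> z \<ge> e \<bullet> x\<^sub>0 - real T * \<beta> * (a / r)"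
  using assms(9)
proof (induction T arbitrary: x y z)
  case 0
  then show ?case using assms(2,3) by auto
next
  case (Suc T)
  let ?X = "{x. 0 \<le> e \<bullet> x}"
  let ?step = "psgda_step ?X Y (\<lambda>x y. a * (e \<bullet> x)) r s c \<alpha> \<beta>"
  obtain u v w where uvw: "(?step ^^ T) (x\<^sub>0, 0, x\<^sub>0) = (u, v, w)" by (metis prod_cases3)
  note IH = Suc.IH[OF uvw]
  have "?step (u, 0, w) = (x, y, z)" using Suc.prems uvw IH by simp
  then have x: "x = closest_point ?X (u - c *\<^sub>R (a *\<^sub>R e + r *\<^sub>R (u - w)))"
    and y: "y = closest_point Y 0" and z: "z = w + \<beta> *\<^sub>R (x - w)"
    by (auto simp: psgda_step_def Let_def grad_F0_linear_x grad_F0_linear_y)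
  have ee: "e \<bullet> e = 1" using assms by (simp add: norm_eq_1)
  have "e \<bullet> (u - c *\<^sub>R (a *\<^sub>R e + r *\<^sub>R (u - w))) \<le> e \<bullet> x"
    unfolding x by (rule closest_point_halfspace)
  \<comment> \<open>Projection only raises \<open>e \<bullet> x\<close>, so the new lag is at most
    an affine image of the old one. This affine map has nonnegative slope \<open>1 - c * r\<close>
    and fixes \<open>a / r\<close>, hence preserves the bound.\<close>
  then have "e \<bullet> w - e \<bullet> x \<le> (1 - c * r) * (e \<bullet> w - e \<bullet> u) + c * a"
    using ee by (simp add: inner_simps algebra_simps)
  also have "\<dots> \<le> (1 - c * r) * (a / r) + c * a"
    using IH assms by (intro add_mono mult_left_mono) auto
  also have "\<dots> = a / r" using assms by (simp add: field_simps)
  finally have lag: "e \<bullet> w - e \<bullet> x \<le> a / r" .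
  have "e \<bullet> z - e \<bullet> x = (1 - \<beta>) * (e \<bullet> w - e \<bullet> x)"
    by (simp add: z inner_simps algebra_simps)
  \<comment> \<open>The lag may be negative, so it is replaced by the positive \<open>a / r\<close>
    before the factor \<open>1 - \<beta>\<close> is dropped.\<close>
  also have "\<dots> \<le> (1 - \<beta>) * (a / r)" using lag assms by (intro mult_left_mono) auto
  also have "\<dots> \<le> 1 * (a / r)" using assms by (intro mult_right_mono) auto
  finally have "e \<bullet> z - e \<bullet> x \<le> a / r" by simp
  moreover have "e \<bullet> w - e \<bullet> z \<le> \<beta> * (a / r)"
    using mult_left_mono[OF lag, of \<beta>] assms by (simp add: z inner_simps algebra_simps)
  then have "e \<bullet> x\<^sub>0 - real (Suc T) * \<beta> * (a / r) \<le> e \<bullet> z"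
    using IH by (simp add: algebra_simps)
  moreover have "y = 0" using assms by (simp add: y closest_point_self)
  ultimately show ?case by simp
qed

text \<open>The scale \<sigma> of the perturbation is left open: items (i) and (ii) are the cases
  \<open>\<epsilon> / D\<close> and \<open>\<epsilon>\<^sup>2 / (l * D\<^sup>2)\<close>. The factor
  \<open>K\<^sup>2\<close> comes from chaining \<open>\<beta> \<le> K * (s / l)\<close> with
  \<open>s \<le> K * \<sigma>\<close>.\<close>

lemma iterations_ge:
  fixes e :: "'a::euclidean_space"
  assumes "norm e = 1" "0 < \<epsilon>" "\<epsilon> \<le> 1" "\<epsilon> < l * \<Delta> / 8" "0 < l" "0 < k" "k \<le> K"
    and steps: "step_sizes k K l r s c \<alpha> \<beta>" and th: "Theta k K s \<sigma>" and "0 < \<sigma>" and "0 \<in> Y"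
    and run: "(psgda_step {x. 0 \<le> e \<bullet> x} Y (\<lambda>x y. 2 * \<epsilon> * (e \<bullet> x)) r s c \<alpha> \<beta> ^^ T)
      ((\<Delta> / (2 * \<epsilon>)) *\<^sub>R e, 0, (\<Delta> / (2 * \<epsilon>)) *\<^sub>R e) = (x, y, z)"
    and "e \<bullet> x \<le> \<epsilon> / l"
  shows "real T \<ge> 1 / (3 * K\<^sup>2) * (l\<^sup>2 * \<Delta> / (\<sigma> * \<epsilon>\<^sup>2))"
proof -
  have r: "r > 3 * l" and c: "0 < c" "c < 1 / (r + l + s)" and \<beta>: "0 < \<beta>" "\<beta> \<le> 1 / 36" "\<beta> \<le> K * (s / l)"
    and s: "0 < s" "s \<le> K * \<sigma>"
    using steps th by (auto simp: step_sizes_def Theta_def)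
  have "c * r \<le> c * (r + l + s)" using c s \<open>0 < l\<close> by (intro mult_left_mono) auto
  also have "\<dots> \<le> 1" using c s r \<open>0 < l\<close> by (simp add: field_simps)
  finally have "c * r \<le> 1" .
  then have "e \<bullet> z - e \<bullet> x \<le> 2 * \<epsilon> / r \<and>
      e \<bullet> z \<ge> e \<bullet> ((\<Delta> / (2 * \<epsilon>)) *\<^sub>R e) - real T * \<beta> * (2 * \<epsilon> / r)"
    using psgda_linear_inner_ge[OF _ _ _ _ _ _ _ _ run] assms r c \<beta> by simp
  moreover have "e \<bullet> e = 1" using assms by (simp add: norm_eq_1)
  \<comment> \<open>The \<open>T\<close> anchor moves account for \<open>real T * \<beta>\<close>,
    and the final lag of \<open>x\<close> behind the anchor for the extra \<open>1\<close>.\<close>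
  ultimately have "\<Delta> / (2 * \<epsilon>) \<le> e \<bullet> x + (real T * \<beta> + 1) * (2 * \<epsilon> / r)"
    by (simp add: distrib_right add_divide_distrib)
  also have "\<dots> \<le> \<epsilon> / l + (real T * \<beta> + 1) * (2 * \<epsilon> / (3 * l))"
    using assms r \<beta> by (intro add_mono mult_left_mono divide_left_mono) auto
  finally have "l * \<Delta> / 2 \<le> \<epsilon>\<^sup>2 * (5 / 3 + 2 / 3 * (real T * \<beta>))"
    using assms by (simp add: field_simps power2_eq_square)
  moreover have "\<epsilon>\<^sup>2 \<le> \<epsilon>" using assms by (simp add: power2_eq_square)
  \<comment> \<open>As \<open>\<epsilon>\<^sup>2 \<le> \<epsilon> < l * \<Delta> / 8\<close>, the
    constant term is at most \<open>5 * l * \<Delta> / 24\<close>. The remaining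
    \<open>7 * l * \<Delta> / 24\<close> gives the factor \<open>16 / 7\<close>, rounded up to
    \<open>3\<close>.\<close>
  ultimately have "l * \<Delta> \<le> 3 * (real T * \<epsilon>\<^sup>2) * \<beta>"
    using assms \<beta> by (simp add: algebra_simps)
  also have "\<dots> \<le> 3 * (real T * \<epsilon>\<^sup>2) * (K * ((K * \<sigma>) / l))"
    using assms s \<beta>
    by (intro mult_left_mono order_trans[OF \<beta>(3)] divide_right_mono) auto
  finally show ?thesis using assms by (simp add: field_simps power2_eq_square)
qed

theorem theorem3p4:
  fixes k K :: real
  assumes "0 < k" and "k \<le> K"
  shows "\<exists>C>0. \<forall>l>0. \<forall>D>0. \<forall>\<Delta>>0. \<exists>\<epsilon>\<^sub>0. 0 < \<epsilon>\<^sub>0 \<and> \<epsilon>\<^sub>0 \<le> 1 \<and>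
    (\<forall>\<epsilon> r\<^sub>x r\<^sub>y c \<alpha> \<beta> r\<^sub>x' r\<^sub>y' c' \<alpha>' \<beta>'.
      0 < \<epsilon> \<longrightarrow> \<epsilon> < \<epsilon>\<^sub>0 \<longrightarrow>
      step_sizes k K l r\<^sub>x r\<^sub>y c \<alpha> \<beta> \<longrightarrow> Theta k K r\<^sub>y (\<epsilon> / D) \<longrightarrow>
      step_sizes k K l r\<^sub>x' r\<^sub>y' c' \<alpha>' \<beta>' \<longrightarrow> Theta k K r\<^sub>y' (\<epsilon>\<^sup>2 / (l * D\<^sup>2)) \<longrightarrow>
      (\<exists>(X :: (real ^ 'n) set) (Y :: (real ^ 'd) set) f x\<^sub>0 y\<^sub>0 z\<^sub>0.
        minimax_problem l X Y f \<and> diameter Y = D \<and>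
        x\<^sub>0 \<in> X \<and> y\<^sub>0 \<in> Y \<and>
        minimax_attained X Y f r\<^sub>y \<and> Delta_Psi2 X Y f r\<^sub>x r\<^sub>y x\<^sub>0 y\<^sub>0 z\<^sub>0 = \<Delta> \<and>
        minimax_attained X Y f r\<^sub>y' \<and> Delta_Psi2 X Y f r\<^sub>x' r\<^sub>y' x\<^sub>0 y\<^sub>0 z\<^sub>0 = \<Delta> \<and>
        (\<forall>T x y z.
          (psgda_step X Y f r\<^sub>x r\<^sub>y c \<alpha> \<beta> ^^ T) (x\<^sub>0, y\<^sub>0, z\<^sub>0) = (x, y, z) \<longrightarrow>
          game_stationary \<epsilon> X Y f x y \<longrightarrow>
          real T \<ge> C * (l\<^sup>2 * D * \<Delta> / \<epsilon> ^ 3)) \<and>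
        (\<forall>T x y z.
          (psgda_step X Y f r\<^sub>x' r\<^sub>y' c' \<alpha>' \<beta>' ^^ T) (x\<^sub>0, y\<^sub>0, z\<^sub>0) = (x, y, z) \<longrightarrow>
          optimization_stationary \<epsilon> l X Y f x \<longrightarrow>
          real T \<ge> C * (l ^ 3 * D\<^sup>2 * \<Delta> / \<epsilon> ^ 4))))"
proof (rule exI[of _ "1 / (3 * K\<^sup>2)"], intro conjI allI impI)
  show "0 < 1 / (3 * K\<^sup>2)" using assms by simp
next
  fix l D \<Delta> :: real
  assume pos: "0 < l" "0 < D" "0 < \<Delta>"
  show "\<exists>\<epsilon>\<^sub>0. 0 < \<epsilon>\<^sub>0 \<and> \<epsilon>\<^sub>0 \<le> 1 \<and>
    (\<forall>\<epsilon> r\<^sub>x r\<^sub>y c \<alpha> \<beta> r\<^sub>x' r\<^sub>y' c' \<alpha>' \<beta>'.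
      0 < \<epsilon> \<longrightarrow> \<epsilon> < \<epsilon>\<^sub>0 \<longrightarrow>
      step_sizes k K l r\<^sub>x r\<^sub>y c \<alpha> \<beta> \<longrightarrow> Theta k K r\<^sub>y (\<epsilon> / D) \<longrightarrow>
      step_sizes k K l r\<^sub>x' r\<^sub>y' c' \<alpha>' \<beta>' \<longrightarrow> Theta k K r\<^sub>y' (\<epsilon>\<^sup>2 / (l * D\<^sup>2)) \<longrightarrow>
      (\<exists>(X :: (real ^ 'n) set) (Y :: (real ^ 'd) set) f x\<^sub>0 y\<^sub>0 z\<^sub>0.
        minimax_problem l X Y f \<and> diameter Y = D \<and>
        x\<^sub>0 \<in> X \<and> y\<^sub>0 \<in> Y \<and>
        minimax_attained X Y f r\<^sub>y \<and> Delta_Psi2 X Y f r\<^sub>x r\<^sub>y x\<^sub>0 y\<^sub>0 z\<^sub>0 = \<Delta> \<and>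
        minimax_attained X Y f r\<^sub>y' \<and> Delta_Psi2 X Y f r\<^sub>x' r\<^sub>y' x\<^sub>0 y\<^sub>0 z\<^sub>0 = \<Delta> \<and>
        (\<forall>T x y z.
          (psgda_step X Y f r\<^sub>x r\<^sub>y c \<alpha> \<beta> ^^ T) (x\<^sub>0, y\<^sub>0, z\<^sub>0) = (x, y, z) \<longrightarrow>
          game_stationary \<epsilon> X Y f x y \<longrightarrow>
          real T \<ge> 1 / (3 * K\<^sup>2) * (l\<^sup>2 * D * \<Delta> / \<epsilon> ^ 3)) \<and>
        (\<forall>T x y z.
          (psgda_step X Y f r\<^sub>x' r\<^sub>y' c' \<alpha>' \<beta>' ^^ T) (x\<^sub>0, y\<^sub>0, z\<^sub>0) = (x, y, z) \<longrightarrow>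
          optimization_stationary \<epsilon> l X Y f x \<longrightarrow>
          real T \<ge> 1 / (3 * K\<^sup>2) * (l ^ 3 * D\<^sup>2 * \<Delta> / \<epsilon> ^ 4))))"
  \<comment> \<open>The bound \<open>1\<close> ensures
    \<open>\<epsilon>\<^sup>2 \<le> \<epsilon>\<close>; the bound \<open>l * \<Delta> / 8\<close>
    lets the constant term of the iteration count be absorbed into
    \<open>l * \<Delta>\<close>.\<close>
  proof (rule exI[of _ "min 1 (l * \<Delta> / 8)"], intro conjI allI impI)
    show "0 < min 1 (l * \<Delta> / 8)" using pos by simp
    show "min 1 (l * \<Delta> / 8) \<le> 1" by simp
    fix \<epsilon> r\<^sub>x r\<^sub>y c \<alpha> \<beta> r\<^sub>x' r\<^sub>y' c' \<alpha>' \<beta>' :: real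
    assume \<epsilon>: "0 < \<epsilon>" "\<epsilon> < min 1 (l * \<Delta> / 8)"
      and steps: "step_sizes k K l r\<^sub>x r\<^sub>y c \<alpha> \<beta>" "Theta k K r\<^sub>y (\<epsilon> / D)"
      and steps': "step_sizes k K l r\<^sub>x' r\<^sub>y' c' \<alpha>' \<beta>'" "Theta k K r\<^sub>y' (\<epsilon>\<^sup>2 / (l * D\<^sup>2))"
    obtain e :: "real ^ 'n" where e: "norm e = 1" by (metis vector_choose_size zero_le_one)
    have ee: "e \<bullet> e = 1" using e by (simp add: norm_eq_1)
    have ry: "0 < r\<^sub>y" "0 < r\<^sub>y'" using steps steps' by (auto simp: step_sizes_def)
    define X where "X = {x. 0 \<le> e \<bullet> x}"
    define Y :: "(real ^ 'd) set" where "Y = cball 0 (D / 2)"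
    \<comment> \<open>The slope exceeds \<epsilon>, as both stationarity lemmas demand, and turns
      the proximal threshold \<open>a / (2 * l)\<close> into \<open>\<epsilon> / l\<close>.\<close>
    define f where "f = (\<lambda>x (y :: real ^ 'd). 2 * \<epsilon> * (e \<bullet> x))"
    \<comment> \<open>The height is chosen so that the objective at the start equals \<Delta>, which
      is then the gap for both parameter sets.\<close>
    define x\<^sub>0 where "x\<^sub>0 = (\<Delta> / (2 * \<epsilon>)) *\<^sub>R e"
    note defs = X_def f_def x\<^sub>0_def
    have Y: "0 \<in> Y" using pos by (simp add: Y_def)
    have "minimax_problem l X Y f"
      unfolding X_def Y_def f_def using pos by (intro minimax_problem_linear)
    moreover have "diameter Y = D" using pos by (simp add: Y_def diameter_cball)
    moreover have "x\<^sub>0 \<in> X" using pos \<epsilon> ee by (simp add: defs)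
    moreover have "minimax_attained X Y f r\<^sub>y" "minimax_attained X Y f r\<^sub>y'"
      unfolding defs using Y ry \<epsilon> by (auto intro!: minimax_attained_linear)
    moreover have "Delta_Psi2 X Y f r\<^sub>x r\<^sub>y x\<^sub>0 0 x\<^sub>0 = \<Delta>" "Delta_Psi2 X Y f r\<^sub>x' r\<^sub>y' x\<^sub>0 0 x\<^sub>0 = \<Delta>"
      using Y ry \<epsilon> ee by (simp_all add: defs Delta_Psi2_linear)
    moreover have "real T \<ge> 1 / (3 * K\<^sup>2) * (l\<^sup>2 * D * \<Delta> / \<epsilon> ^ 3)"
      if run: "(psgda_step X Y f r\<^sub>x r\<^sub>y c \<alpha> \<beta> ^^ T) (x\<^sub>0, 0, x\<^sub>0) = (x, y, z)"
        and gs: "game_stationary \<epsilon> X Y f x y" for T x y z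
    proof -
      have "e \<bullet> x \<le> 0"
        using game_stationary_linear_inner_le[OF gs[unfolded defs] e] \<epsilon> by simp
      also have "\<dots> \<le> \<epsilon> / l" using \<epsilon> pos by simp
      finally have "real T \<ge> 1 / (3 * K\<^sup>2) * (l\<^sup>2 * \<Delta> / (\<epsilon> / D * \<epsilon>\<^sup>2))"
        using \<epsilon> pos assms steps Y by (intro iterations_ge[OF e _ _ _ _ _ _ _ _ _ _ run[unfolded defs]]) auto
      also have "l\<^sup>2 * \<Delta> / (\<epsilon> / D * \<epsilon>\<^sup>2) = l\<^sup>2 * D * \<Delta> / \<epsilon> ^ 3"
        using \<epsilon> pos by (simp add: field_simps eval_nat_numeral)
      finally show ?thesis .
    qed
    moreover have "real T \<ge> 1 / (3 * K\<^sup>2) * (l ^ 3 * D\<^sup>2 * \<Delta> / \<epsilon> ^ 4)"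
      if run: "(psgda_step X Y f r\<^sub>x' r\<^sub>y' c' \<alpha>' \<beta>' ^^ T) (x\<^sub>0, 0, x\<^sub>0) = (x, y, z)"
        and os: "optimization_stationary \<epsilon> l X Y f x" for T x y z
    proof -
      have "Y \<noteq> {}" using Y by blast
      then have "e \<bullet> x \<le> \<epsilon> / l"
        using optimization_stationary_linear_inner_less[OF os[unfolded defs] e] \<epsilon> pos by simp
      then have "real T \<ge> 1 / (3 * K\<^sup>2) * (l\<^sup>2 * \<Delta> / (\<epsilon>\<^sup>2 / (l * D\<^sup>2) * \<epsilon>\<^sup>2))"
        using \<epsilon> pos assms steps' Y by (intro iterations_ge[OF e _ _ _ _ _ _ _ _ _ _ run[unfolded defs]]) auto
      also have "l\<^sup>2 * \<Delta> / (\<epsilon>\<^sup>2 / (l * D\<^sup>2) * \<epsilon>\<^sup>2) = l ^ 3 * D\<^sup>2 * \<Delta> / \<epsilon> ^ 4"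
        using \<epsilon> pos by (simp add: field_simps eval_nat_numeral)
      finally show ?thesis .
    qed
    ultimately show "\<exists>(X :: (real ^ 'n) set) (Y :: (real ^ 'd) set) f x\<^sub>0 y\<^sub>0 z\<^sub>0.
        minimax_problem l X Y f \<and> diameter Y = D \<and>
        x\<^sub>0 \<in> X \<and> y\<^sub>0 \<in> Y \<and>
        minimax_attained X Y f r\<^sub>y \<and> Delta_Psi2 X Y f r\<^sub>x r\<^sub>y x\<^sub>0 y\<^sub>0 z\<^sub>0 = \<Delta> \<and>
        minimax_attained X Y f r\<^sub>y' \<and> Delta_Psi2 X Y f r\<^sub>x' r\<^sub>y' x\<^sub>0 y\<^sub>0 z\<^sub>0 = \<Delta> \<and>
        (\<forall>T x y z.
          (psgda_step X Y f r\<^sub>x r\<^sub>y c \<alpha> \<beta> ^^ T) (x\<^sub>0, y\<^sub>0, z\<^sub>0) = (x, y, z) \<longrightarrow>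
          game_stationary \<epsilon> X Y f x y \<longrightarrow>
          real T \<ge> 1 / (3 * K\<^sup>2) * (l\<^sup>2 * D * \<Delta> / \<epsilon> ^ 3)) \<and>
        (\<forall>T x y z.
          (psgda_step X Y f r\<^sub>x' r\<^sub>y' c' \<alpha>' \<beta>' ^^ T) (x\<^sub>0, y\<^sub>0, z\<^sub>0) = (x, y, z) \<longrightarrow>
          optimization_stationary \<epsilon> l X Y f x \<longrightarrow>
          real T \<ge> 1 / (3 * K\<^sup>2) * (l ^ 3 * D\<^sup>2 * \<Delta> / \<epsilon> ^ 4))"
      using Y by (intro exI[of _ X] exI[of _ Y] exI[of _ f] exI[of _ x\<^sub>0] exI[of _ 0]) blast
  qed
qed

end
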